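(* Let $R$ be a finite commutative Frobenius ring with $q$ elements, and let $C\subseteq R^N$ be a linear $P_R$-code over a poset $P$ of size $N$ with $s$ levels of sizes $n_1,\dots,n_s$ (so $N=n_1+\cdots+n_s$). Then the complete poset level weight enumerator of the dual code $C^\perp$ satisfies $$C_W\left(C^\perp\mid z_{i:w(\overline a)}:\overline a\in R^{n_i},\ 1\le i\le s\right)=\frac{1}{|C|}\sum_{l}A_l\prod_{j=1}^{s}\left(\sum_{p_j=0}^{n_j}\left\{\sum_{a_j=0}^{p_j}(-1)^{a_j}(q-1)^{p_j-a_j}\binom{l_j}{a_j}\binom{n_j-l_j}{p_j-a_j}\right\}z_{j:p_j}\right),$$ where the sum $\sum_l$ runs over all $l=(l_1,\dots,l_s)$ with $0\le l_j\le n_j$ for each $j$, and $A_l$ is the number of codewords of $C$ having Hamming weight spectrum vector $l$.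
   Context: All rings are finite commutative Frobenius rings (a finite commutative ring $R$ is Frobenius if its character group $\widehat R=\mathrm{Hom}_{\mathbb Z}(R,\mathbb C^\times)$ is isomorphic to $R$ as an $R$-module). A linear code $C$ is an $R$-submodule of $R^N$. The coordinates of $R^N$ are labelled by the elements of a finite poset $P$ of size $N$, which is partitioned into $s$ levels, the $i$th level having $n_i\ge 1$ elements. Such a $C$ is called a linear $P_R$-code. The poset enters only through this partition of the coordinate set. Each $u\in R^N$ is written $u=(u^1,\dots,u^s)$, with $u^i=(u_{i1},\dots,u_{in_i})\in R^{n_i}$ the part of $u$ in level $i$. The inner product is $\langle u,v\rangle=\sum_{i=1}^s\sum_{j=1}^{n_i}u_{ij}v_{ij}$, and $C^\perp=\{v\in R^N:\langle u,v\rangle=0\text{ for all }u\in C\}$. $w$ denotes the Hamming weight (number of nonzero coordinates). The Hamming weight spectrum vector of $u\in R^N$ is $(w(u^1),\dots,w(u^s))$. Let $z_{i:k}$ ($1\le i\le s$, $0\le k\le n_i$) be commuting indeterminates. The complete poset level weight enumerator of a linear $P_R$-code $C$ is $$C_W\left(C\mid z_{i:w(\overline a)}:\overline a\in R^{n_i},1\le i\le s\right)=\sum_{u\in C}\prod_{i=1}^{s}z_{i:w(u^i)},$$ and that of $C^\perp$ is defined by the same formula with $C^\perp$ in place of $C$ (same levels). Binomial conventions: $\binom{n}{k}=0$ if $n<k$ and $\binom00=1$. *)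

theory Defs
  imports "HOL-Analysis.Analysis" "HOL-Library.Poly_Mapping"
begin

text \<open>Homomorphisms from the additive group of a ring to the multiplicative group of nonzero
  complex numbers.\<close>

definition additive_characters :: "('a::comm_ring_1 \<Rightarrow> complex) set" where
  "additive_characters = {\<psi>. (\<forall>x. \<psi> x \<noteq> 0) \<and> (\<forall>x y. \<psi> (x + y) = \<psi> x * \<psi> y)}"

text \<open>The characters form a group under pointwise multiplication and a module over the ring under
  \<open>(r \<cdot> \<psi>) x = \<psi> (r * x)\<close>. The map \<open>\<phi>\<close> below is an isomorphism from the ring, as a module over
  itself, to this module.\<close>

definition frobenius_ring :: "'a::{comm_ring_1, finite} itself \<Rightarrow> bool" where
  "frobenius_ring _ \<longleftrightarrow>
     (\<exists>\<phi> :: 'a \<Rightarrow> 'a \<Rightarrow> complex.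
        bij_betw \<phi> UNIV additive_characters \<and>
        (\<forall>a b. \<phi> (a + b) = (\<lambda>x. \<phi> a x * \<phi> b x)) \<and>
        (\<forall>r a. \<phi> (r * a) = (\<lambda>x. \<phi> a (r * x))))"

text \<open>\<open>L 1, \<dots>, L s\<close> are the levels, and \<open>n i\<close> is the size of the \<open>i\<close>-th one.\<close>

definition level_partition :: "nat \<Rightarrow> (nat \<Rightarrow> nat) \<Rightarrow> (nat \<Rightarrow> 'p set) \<Rightarrow> bool" where
  "level_partition s n L \<longleftrightarrow>
     disjoint_family_on L {1..s} \<and> (\<Union>i\<in>{1..s}. L i) = UNIV \<and>
     (\<forall>i\<in>{1..s}. card (L i) = n i \<and> n i \<ge> 1)"

text \<open>The library interprets \<open>module\<close> for \<open>(*s)\<close> over fields only.\<close>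

lemma module_vec: "module ((*s) :: 'a::comm_ring_1 \<Rightarrow> 'a ^ 'p \<Rightarrow> 'a ^ 'p)"
  by standard (simp_all add: vec_eq_iff algebra_simps)

definition linear_code :: "('a::comm_ring_1 ^ 'p) set \<Rightarrow> bool" where
  "linear_code C \<longleftrightarrow> module.subspace (*s) C"

definition level_inner ::
  "nat \<Rightarrow> (nat \<Rightarrow> 'p set) \<Rightarrow> 'a::comm_ring_1 ^ 'p \<Rightarrow> 'a ^ 'p \<Rightarrow> 'a" where
  "level_inner s L u v = (\<Sum>i\<in>{1..s}. \<Sum>p\<in>L i. u $ p * v $ p)"

definition dual_code ::
  "nat \<Rightarrow> (nat \<Rightarrow> 'p set) \<Rightarrow> ('a::comm_ring_1 ^ 'p) set \<Rightarrow> ('a ^ 'p) set" where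
  "dual_code s L C = {v. \<forall>u\<in>C. level_inner s L u v = 0}"

text \<open>The Hamming weight of the part of \<open>u\<close> supported on level \<open>i\<close>.\<close>

definition level_weight :: "(nat \<Rightarrow> 'p set) \<Rightarrow> 'a::zero ^ 'p \<Rightarrow> nat \<Rightarrow> nat" where
  "level_weight L u i = card {p \<in> L i. u $ p \<noteq> 0}"

text \<open>Spectrum vectors are extensional functions on \<open>{1..s}\<close>, so that equality of functions is
  equality of vectors.\<close>

definition weight_spectrum ::
  "nat \<Rightarrow> (nat \<Rightarrow> 'p set) \<Rightarrow> 'a::zero ^ 'p \<Rightarrow> (nat \<Rightarrow> nat)" where
  "weight_spectrum s L u = (\<lambda>i\<in>{1..s}. level_weight L u i)"

definition spectrum_count ::
  "nat \<Rightarrow> (nat \<Rightarrow> 'p set) \<Rightarrow> ('a::zero ^ 'p) set \<Rightarrow> (nat \<Rightarrow> nat) \<Rightarrow> nat" where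
  "spectrum_count s L C l = card {u \<in> C. weight_spectrum s L u = l}"

text \<open>Polynomials with rational coefficients in indeterminates indexed by pairs \<open>(i, k)\<close>: a monomial
  is its finitely supported exponent function, and a polynomial maps monomials to coefficients.\<close>

type_synonym level_poly = "(nat \<times> nat \<Rightarrow>\<^sub>0 nat) \<Rightarrow>\<^sub>0 rat"

definition indet :: "nat \<Rightarrow> nat \<Rightarrow> level_poly" where
  "indet i k = Poly_Mapping.single (Poly_Mapping.single (i, k) 1) 1"

definition const_poly :: "rat \<Rightarrow> level_poly" where
  "const_poly c = Poly_Mapping.single 0 c"

definition level_weight_enumerator ::
  "nat \<Rightarrow> (nat \<Rightarrow> 'p set) \<Rightarrow> ('a::zero ^ 'p) set \<Rightarrow> level_poly" where
  "level_weight_enumerator s L C = (\<Sum>u\<in>C. \<Prod>i\<in>{1..s}. indet i (level_weight L u i))"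

end

theory Submission
  imports Defs
begin

text \<open>
  Over a Frobenius ring the character \<open>\<psi>\<close> corresponding to \<open>1\<close> is nontrivial on every nonzero
  ideal, so \<open>\<Sum>u\<in>C. \<psi> \<langle>u, v\<rangle>\<close> is \<open>card C\<close> if \<open>v\<close> lies in the dual code and \<open>0\<close> otherwise. Sum this
  over all \<open>v\<close> with spectrum \<open>m\<close> and exchange the sums. For fixed \<open>u\<close>, the vectors \<open>v\<close> with support
  \<open>S\<close> contribute a factor \<open>- 1\<close> for each \<open>p \<in> S\<close> with \<open>u $ p \<noteq> 0\<close> and a factor \<open>q - 1\<close> for each
  other \<open>p \<in> S\<close>; summing over the supports level by level gives a product of Krawtchouk values.
  This yields the coefficients of the enumerator of the dual code one spectrum at a time, as an
  identity of complex numbers both sides of which are rational.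
\<close>

section \<open>Krawtchouk values as sums over subsets\<close>

text \<open>For \<open>l\<close> at most \<open>n\<close>, this is the coefficient of z^p in (1 -
  z)^l * (1 + (q - 1) * z)^(n - l). The target ring is left open because the values arise as complex
  character sums but are needed as rational coefficients.\<close>

definition krawtchouk :: "nat \<Rightarrow> nat \<Rightarrow> nat \<Rightarrow> nat \<Rightarrow> 'b::comm_ring_1" where
  "krawtchouk q n l p = (\<Sum>a=0..p. (-1) ^ a * (of_nat q - 1) ^ (p - a) *
     of_nat (l choose a) * of_nat ((n - l) choose (p - a)))"

lemma of_rat_krawtchouk: "of_rat (krawtchouk q n l p) = (krawtchouk q n l p :: complex)"
  by (simp add: krawtchouk_def of_rat_sum of_rat_mult of_rat_power of_rat_diff of_rat_minus)

text \<open>A subset of \<open>A\<close> amounts to independent choices of its part inside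
  \<open>U\<close> and its part outside \<open>U\<close>.\<close>

lemma card_subsets_split:
  assumes "finite A" "U \<subseteq> A"
  shows "card {S. S \<subseteq> A \<and> card (S \<inter> U) = a \<and> card (S - U) = b} =
    (card U choose a) * ((card A - card U) choose b)"
proof -
  have finU: "finite U" using assms finite_subset by blast
  have "bij_betw (\<lambda>S. (S \<inter> U, S - U))
      {S. S \<subseteq> A \<and> card (S \<inter> U) = a \<and> card (S - U) = b}
      ({T. T \<subseteq> U \<and> card T = a} \<times> {T. T \<subseteq> A - U \<and> card T = b})"
  proof (rule bij_betw_byWitness[where f' = "\<lambda>(T, T'). T \<union> T'"])
    show "(\<lambda>(T, T'). T \<union> T') ` ({T. T \<subseteq> U \<and> card T = a} \<times> {T. T \<subseteq> A - U \<and> card T = b})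
      \<subseteq> {S. S \<subseteq> A \<and> card (S \<inter> U) = a \<and> card (S - U) = b}"
    proof clarsimp
      fix T T' assume T: "T \<subseteq> U" "T' \<subseteq> A - U"
      then have "(T \<union> T') \<inter> U = T" "(T \<union> T') - U = T'" by auto
      then show "T \<subseteq> A \<and> T' \<subseteq> A \<and> card ((T \<union> T') \<inter> U) = card T \<and> card (T \<union> T' - U) = card T'"
        using T assms by auto
    qed
  qed auto
  then have "card {S. S \<subseteq> A \<and> card (S \<inter> U) = a \<and> card (S - U) = b} =
      card {T. T \<subseteq> U \<and> card T = a} * card {T. T \<subseteq> A - U \<and> card T = b}"
    by (simp add: bij_betw_same_card card_cartesian_product)
  also have "\<dots> = (card U choose a) * ((card A - card U) choose b)"
    using assms finU by (simp add: n_subsets card_Diff_subset)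
  finally show ?thesis .
qed

text \<open>The product depends on \<open>S\<close> only through the number \<open>a\<close> of its
  elements satisfying \<open>P\<close>, so the subsets are grouped by \<open>a\<close>. With x = -1
  and y = q - 1 the right-hand side is a Krawtchouk value.\<close>

lemma sum_subsets_prod_two_valued:
  fixes x y :: "'b::comm_semiring_1"
  assumes "finite A"
  shows "(\<Sum>S | S \<subseteq> A \<and> card S = k. \<Prod>i\<in>S. if P i then x else y) =
    (\<Sum>a=0..k. x ^ a * y ^ (k - a) * of_nat (card {i\<in>A. P i} choose a) *
       of_nat ((card A - card {i\<in>A. P i}) choose (k - a)))"
proof -
  define U where "U = {i\<in>A. P i}"
  have U: "U \<subseteq> A" by (auto simp: U_def)
  have card_split: "card S = card (S \<inter> U) + card (S - U)" if "S \<subseteq> A" for S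
    using card_Int_Diff finite_subset[OF that assms] by blast
  have val: "(\<Prod>i\<in>S. if P i then x else y) = x ^ card (S \<inter> U) * y ^ card (S - U)"
    if "S \<subseteq> A" for S
  proof -
    have "finite S" using that assms finite_subset by blast
    moreover have "S \<inter> {i. P i} = S \<inter> U" "S \<inter> - {i. P i} = S - U"
      using that by (auto simp: U_def)
    ultimately show ?thesis by (simp add: prod.If_cases)
  qed
  have "(\<Sum>S | S \<subseteq> A \<and> card S = k. \<Prod>i\<in>S. if P i then x else y) =
      (\<Sum>a=0..k. \<Sum>S\<in>{S \<in> {S. S \<subseteq> A \<and> card S = k}. card (S \<inter> U) = a}.
         \<Prod>i\<in>S. if P i then x else y)"
    using assms card_split by (subst sum.group) auto
  also have "\<dots> = (\<Sum>a=0..k. x ^ a * y ^ (k - a) * of_nat (card U choose a) *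
       of_nat ((card A - card U) choose (k - a)))"
  proof (rule sum.cong[OF refl])
    fix a assume "a \<in> {0..k}"
    then have eq: "{S \<in> {S. S \<subseteq> A \<and> card S = k}. card (S \<inter> U) = a} =
        {S. S \<subseteq> A \<and> card (S \<inter> U) = a \<and> card (S - U) = k - a}"
      using card_split by auto
    have "(\<Sum>S\<in>{S \<in> {S. S \<subseteq> A \<and> card S = k}. card (S \<inter> U) = a}. \<Prod>i\<in>S. if P i then x else y) =
        (\<Sum>S | S \<subseteq> A \<and> card (S \<inter> U) = a \<and> card (S - U) = k - a. x ^ a * y ^ (k - a))"
      unfolding eq by (rule sum.cong) (auto simp: val)
    also have "\<dots> = x ^ a * y ^ (k - a) * of_nat (card U choose a) *
       of_nat ((card A - card U) choose (k - a))"
      by (simp add: card_subsets_split[OF assms U] algebra_simps)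
    finally show "(\<Sum>S\<in>{S \<in> {S. S \<subseteq> A \<and> card S = k}. card (S \<inter> U) = a}.
        \<Prod>i\<in>S. if P i then x else y) = x ^ a * y ^ (k - a) * of_nat (card U choose a) *
       of_nat ((card A - card U) choose (k - a))" .
  qed
  finally show ?thesis by (simp add: U_def)
qed

section \<open>Generating characters and their sums\<close>

text \<open>Translation by \<open>g\<close> permutes \<open>G\<close>: it is an injective self-map
  of a finite set. It also multiplies the sum by \<open>f g\<close>, which differs from 1.\<close>

lemma character_sum_eq_0:
  fixes f :: "'b::ab_group_add \<Rightarrow> complex"
  assumes "finite G" and add: "\<And>x y. x \<in> G \<Longrightarrow> y \<in> G \<Longrightarrow> x + y \<in> G"
    and f: "\<And>x y. f (x + y) = f x * f y" and g: "g \<in> G" "f g \<noteq> 1"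
  shows "(\<Sum>x\<in>G. f x) = 0"
proof -
  have "(\<lambda>x. g + x) ` G = G"
    by (rule endo_inj_surj) (use assms in auto)
  then have "(\<Sum>x\<in>G. f x) = (\<Sum>x\<in>G. f (g + x))"
    by (metis (no_types, lifting) add_left_imp_eq inj_onI sum.reindex_cong)
  also have "\<dots> = f g * (\<Sum>x\<in>G. f x)"
    by (simp add: f sum_distrib_left)
  finally show ?thesis using g by auto
qed

text \<open>By \<open>generating\<close>, only r = 0 gives the trivial character x \<mapsto> \<psi>
  (r * x). This is the form in which the Frobenius property enters all later arguments.\<close>

locale generating_character =
  fixes \<psi> :: "'a::{comm_ring_1, finite} \<Rightarrow> complex"
  assumes nonzero: "\<psi> x \<noteq> 0"
    and add: "\<psi> (x + y) = \<psi> x * \<psi> y"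
    and generating: "r \<noteq> 0 \<Longrightarrow> \<exists>x. \<psi> (r * x) \<noteq> 1"

text \<open>By linearity every \<open>\<phi> r\<close> is the multiple of \<open>\<phi> 1\<close> by
  \<open>r\<close>. If \<open>\<phi> 1\<close> were trivial on the ideal generated by some nonzero
  \<open>r\<close>, then \<open>\<phi> r\<close> and \<open>\<phi> 0\<close> would both be
  constantly 1, against injectivity.\<close>

lemma frobenius_ring_generating_character:
  assumes "frobenius_ring TYPE('a::{comm_ring_1, finite})"
  obtains \<psi> :: "'a::{comm_ring_1, finite} \<Rightarrow> complex" where "generating_character \<psi>"
proof -
  from assms obtain \<phi> :: "'a \<Rightarrow> 'a \<Rightarrow> complex" where
    bij: "bij_betw \<phi> UNIV additive_characters" and
    mul: "\<And>r a. \<phi> (r * a) = (\<lambda>x. \<phi> a (r * x))"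
    unfolding frobenius_ring_def by auto
  have char: "\<phi> r \<in> additive_characters" for r
    using bij by (auto simp: bij_betw_def)
  have scale: "\<phi> r x = \<phi> 1 (r * x)" for r x
    using mul[of r 1] by simp
  have one: "\<phi> 1 0 = 1"
    using char[of 1] unfolding additive_characters_def
    by simp (metis add_0 mult_cancel_right1)
  have "generating_character (\<phi> 1)"
  proof
    show "\<exists>x. \<phi> 1 (r * x) \<noteq> 1" if "r \<noteq> 0" for r
    proof (rule ccontr)
      assume "\<not> (\<exists>x. \<phi> 1 (r * x) \<noteq> 1)"
      then have "\<phi> r = \<phi> 0"
        by (auto simp: scale[of r] scale[of 0] one)
      then show False
        using bij that by (auto simp: bij_betw_def inj_on_def)
    qed
  qed (use char[of 1] in \<open>auto simp: additive_characters_def\<close>)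
  then show ?thesis by (rule that)
qed

context generating_character
begin

lemma zero [simp]: "\<psi> 0 = 1"
  using add[of 0 0] nonzero[of 0] by simp

lemma sum_eq_prod: "\<psi> (\<Sum>i\<in>A. f i) = (\<Prod>i\<in>A. \<psi> (f i))"
  by (induction A rule: infinite_finite_induct) (auto simp: add)

text \<open>The sum over the whole ring is 0 for a nontrivial character and q for the trivial one;
  the term at 0, which equals 1, is then removed.\<close>

lemma sum_nonzero:
  "(\<Sum>x\<in>-{0}. \<psi> (r * x)) = (if r \<noteq> 0 then - 1 else of_nat CARD('a) - 1)"
proof -
  have "(\<Sum>x\<in>UNIV. \<psi> (r * x)) = (if r \<noteq> 0 then 0 else of_nat CARD('a))"
    using character_sum_eq_0[of UNIV "\<lambda>x. \<psi> (r * x)"] generating[of r]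
    by (auto simp: algebra_simps add)
  moreover have "(\<Sum>x\<in>UNIV. \<psi> (r * x)) = 1 + (\<Sum>x\<in>-{0}. \<psi> (r * x))"
    by (subst sum.remove[of _ 0]) (auto simp: Compl_eq_Diff_UNIV)
  ultimately show ?thesis
    by (auto simp: eq_neg_iff_add_eq_0 eq_diff_eq add.commute)
qed

text \<open>The coordinates of \<open>v\<close> vary independently, over the nonzero elements on
  \<open>S\<close> and over {0} elsewhere. As \<psi> turns the inner product into a product, the sum
  factors over coordinates; those outside \<open>S\<close> contribute 1.\<close>

lemma sum_fixed_support:
  fixes u :: "'a ^ 'p::finite"
  shows "(\<Sum>v | {p. v $ p \<noteq> 0} = S. \<psi> (\<Sum>p\<in>UNIV. u $ p * v $ p)) =
    (\<Prod>p\<in>S. if u $ p \<noteq> 0 then - 1 else of_nat CARD('a) - 1)"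
proof -
  define B :: "'p \<Rightarrow> 'a set" where "B = (\<lambda>p. if p \<in> S then -{0} else {0})"
  have "(\<Sum>v | {p. v $ p \<noteq> 0} = S. \<psi> (\<Sum>p\<in>UNIV. u $ p * v $ p)) =
      (\<Sum>v | {p. v $ p \<noteq> 0} = S. \<Prod>p\<in>UNIV. \<psi> (u $ p * v $ p))"
    by (simp add: sum_eq_prod)
  also have "\<dots> = (\<Sum>g\<in>PiE UNIV B. \<Prod>p\<in>UNIV. \<psi> (u $ p * g p))"
    by (rule sum.reindex_bij_witness[where i = vec_lambda and j = vec_nth])
      (auto simp: B_def PiE_iff split: if_splits)
  also have "\<dots> = (\<Prod>p\<in>UNIV. \<Sum>x\<in>B p. \<psi> (u $ p * x))"
    by (simp add: prod_sum_PiE)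
  also have "\<dots> = (\<Prod>p\<in>UNIV. if p \<in> S then if u $ p \<noteq> 0 then - 1 else of_nat CARD('a) - 1 else 1)"
    by (rule prod.cong) (auto simp: B_def sum_nonzero)
  also have "\<dots> = (\<Prod>p\<in>S. if u $ p \<noteq> 0 then - 1 else of_nat CARD('a) - 1)"
    by (simp add: prod.If_cases)
  finally show ?thesis .
qed

end

section \<open>Decomposition by levels and by spectra\<close>

text \<open>Because the levels partition the coordinates, a set \<open>S\<close> is the same as a
  family of freely chosen slices \<open>S \<inter> L i\<close>, and the product over
  \<open>S\<close> splits accordingly.\<close>

lemma sum_prod_over_partition:
  fixes g :: "'p::finite \<Rightarrow> 'b::comm_semiring_1"
  assumes "finite I" and disj: "disjoint_family_on L I" and cover: "(\<Union>i\<in>I. L i) = UNIV"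
  shows "(\<Sum>S | \<forall>i\<in>I. card (S \<inter> L i) = m i. \<Prod>p\<in>S. g p) =
    (\<Prod>i\<in>I. \<Sum>T | T \<subseteq> L i \<and> card T = m i. \<Prod>p\<in>T. g p)"
proof -
  have uniq: "i = j" if "i \<in> I" "j \<in> I" "p \<in> L i" "p \<in> L j" for i j p
    using disj that by (auto simp: disjoint_family_on_def)
  \<comment> \<open>Disjointness of the levels recovers each slice from the union, which makes the
    two witness maps below mutually inverse.\<close>
  have slice: "(\<Union>i\<in>I. h i) \<inter> L j = h j"
    if "h \<in> (\<Pi>\<^sub>E i\<in>I. {T. T \<subseteq> L i \<and> card T = m i})" "j \<in> I" for h j
    using that uniq by (fastforce simp: PiE_iff)
  have "(\<Sum>S | \<forall>i\<in>I. card (S \<inter> L i) = m i. \<Prod>p\<in>S. g p) =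
      (\<Sum>h\<in>(\<Pi>\<^sub>E i\<in>I. {T. T \<subseteq> L i \<and> card T = m i}). \<Prod>i\<in>I. \<Prod>p\<in>h i. g p)"
  proof (rule sum.reindex_bij_witness[where i = "\<lambda>h. \<Union>i\<in>I. h i" and j = "\<lambda>S. \<lambda>i\<in>I. S \<inter> L i"])
    fix S :: "'p set"
    show "(\<Union>i\<in>I. (\<lambda>i\<in>I. S \<inter> L i) i) = S"
      using cover by auto
    have "(\<Prod>i\<in>I. \<Prod>p\<in>S \<inter> L i. g p) = prod g (\<Union>i\<in>I. S \<inter> L i)"
      by (rule prod.UNION_disjoint[symmetric]) (use assms uniq in auto)
    also have "(\<Union>i\<in>I. S \<inter> L i) = S"
      using cover by auto
    finally show "(\<Prod>i\<in>I. prod g ((\<lambda>i\<in>I. S \<inter> L i) i)) = prod g S"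
      by simp
  next
    fix h assume h: "h \<in> (\<Pi>\<^sub>E i\<in>I. {T. T \<subseteq> L i \<and> card T = m i})"
    show "(\<lambda>i\<in>I. (\<Union>i\<in>I. h i) \<inter> L i) = h"
      using h slice[OF h] by (auto simp: PiE_iff extensional_def restrict_def fun_eq_iff)
    show "(\<Union>i\<in>I. h i) \<in> {S. \<forall>i\<in>I. card (S \<inter> L i) = m i}"
      using h slice[OF h] by (auto simp: PiE_iff)
  qed auto
  also have "\<dots> = (\<Prod>i\<in>I. \<Sum>T | T \<subseteq> L i \<and> card T = m i. \<Prod>p\<in>T. g p)"
    using assms(1) by (simp add: prod_sum_PiE)
  finally show ?thesis .
qed

lemma level_inner_eq_sum:
  fixes u v :: "'a::comm_ring_1 ^ 'p::finite"
  assumes "level_partition s n L"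
  shows "level_inner s L u v = (\<Sum>p\<in>UNIV. u $ p * v $ p)"
proof -
  have "(\<Sum>p\<in>(\<Union>i\<in>{1..s}. L i). u $ p * v $ p) = level_inner s L u v"
    unfolding level_inner_def
    by (rule sum.UNION_disjoint)
      (use assms in \<open>auto simp: level_partition_def disjoint_family_on_def\<close>)
  then show ?thesis
    using assms by (simp add: level_partition_def)
qed

lemma level_weight_eq: "level_weight L v i = card ({p. v $ p \<noteq> 0} \<inter> L i)"
  unfolding level_weight_def by (rule arg_cong[where f = card]) auto

lemma weight_spectrum_in_PiE:
  fixes u :: "'a::zero ^ 'p::finite"
  assumes "level_partition s n L"
  shows "weight_spectrum s L u \<in> (\<Pi>\<^sub>E j\<in>{1..s}. {0..n j})"
proof -
  have "level_weight L u i \<le> n i" if "i \<in> {1..s}" for i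
  proof -
    have "level_weight L u i \<le> card (L i)"
      unfolding level_weight_def by (rule card_mono) auto
    then show ?thesis using assms that by (auto simp: level_partition_def)
  qed
  then show ?thesis by (auto simp: weight_spectrum_def)
qed

text \<open>Membership in \<open>PiE\<close> makes \<open>m\<close> undefined outside {1..s}, just
  like a spectrum, so only the levels have to be compared.\<close>

lemma weight_spectrum_eq_iff:
  assumes "m \<in> (\<Pi>\<^sub>E j\<in>{1..s}. B j)"
  shows "weight_spectrum s L u = m \<longleftrightarrow> (\<forall>i\<in>{1..s}. level_weight L u i = m i)"
  using assms by (auto simp: weight_spectrum_def PiE_iff extensional_def restrict_def fun_eq_iff)

text \<open>The values of \<open>f\<close> lie in an arbitrary semiring since this serves twice: for
  complex character sums over the code and for monomials over its dual.\<close>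

lemma sum_by_spectrum:
  fixes C :: "('a::{zero, finite} ^ 'p::finite) set" and f :: "(nat \<Rightarrow> nat) \<Rightarrow> 'b::comm_semiring_1"
  assumes "level_partition s n L"
  shows "(\<Sum>u\<in>C. f (weight_spectrum s L u)) =
    (\<Sum>l\<in>(\<Pi>\<^sub>E j\<in>{1..s}. {0..n j}). of_nat (spectrum_count s L C l) * f l)"
proof -
  have "(\<Sum>u\<in>C. f (weight_spectrum s L u)) =
      (\<Sum>l\<in>(\<Pi>\<^sub>E j\<in>{1..s}. {0..n j}). \<Sum>u | u \<in> C \<and> weight_spectrum s L u = l.
         f (weight_spectrum s L u))"
    by (rule sum.group[symmetric])
      (use weight_spectrum_in_PiE[OF assms] in \<open>auto intro!: finite_PiE\<close>)
  also have "\<dots> = (\<Sum>l\<in>(\<Pi>\<^sub>E j\<in>{1..s}. {0..n j}). of_nat (spectrum_count s L C l) * f l)"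
    by (rule sum.cong) (auto simp: spectrum_count_def)
  finally show ?thesis .
qed

section \<open>Character sums over spectra and codes\<close>

context generating_character
begin

text \<open>Whether \<open>v\<close> has spectrum \<open>m\<close> depends only on its support, so
  the sum is grouped by supports. The result depends on \<open>u\<close> only through its spectrum,
  which is why the counts A_l determine those of the dual code.\<close>

lemma sum_fixed_spectrum:
  fixes u :: "'a ^ 'p::finite"
  assumes levels: "level_partition s n L" and m: "m \<in> (\<Pi>\<^sub>E j\<in>{1..s}. {0..n j})"
  shows "(\<Sum>v | weight_spectrum s L v = m. \<psi> (level_inner s L u v)) =
    (\<Prod>j\<in>{1..s}. krawtchouk CARD('a) (n j) (weight_spectrum s L u j) (m j))"
proof -
  let ?g = "\<lambda>p. if u $ p \<noteq> 0 then - 1 else of_nat CARD('a) - 1 :: complex"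
  let ?T = "{S. \<forall>i\<in>{1..s}. card (S \<inter> L i) = m i}"
  have spec: "weight_spectrum s L v = m \<longleftrightarrow> {p. v $ p \<noteq> 0} \<in> ?T" for v :: "'a ^ 'p"
    unfolding weight_spectrum_eq_iff[OF m] by (simp add: level_weight_eq)
  have "(\<Sum>v | weight_spectrum s L v = m. \<psi> (level_inner s L u v)) =
      (\<Sum>S\<in>?T. \<Sum>v | v \<in> {v. weight_spectrum s L v = m} \<and> {p. v $ p \<noteq> 0} = S.
        \<psi> (level_inner s L u v))"
    by (rule sum.group[symmetric]) (auto simp: spec)
  also have "\<dots> = (\<Sum>S\<in>?T. \<Sum>v | {p. v $ p \<noteq> 0} = S. \<psi> (\<Sum>p\<in>UNIV. u $ p * v $ p))"
    by (intro sum.cong refl) (auto simp: spec level_inner_eq_sum[OF levels])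
  also have "\<dots> = (\<Sum>S\<in>?T. \<Prod>p\<in>S. ?g p)"
    by (simp add: sum_fixed_support)
  also have "\<dots> = (\<Prod>j\<in>{1..s}. \<Sum>S | S \<subseteq> L j \<and> card S = m j. \<Prod>p\<in>S. ?g p)"
    by (rule sum_prod_over_partition) (use levels in \<open>auto simp: level_partition_def\<close>)
  also have "\<dots> = (\<Prod>j\<in>{1..s}. krawtchouk CARD('a) (n j) (weight_spectrum s L u j) (m j))"
    \<comment> \<open>On level \<open>j\<close> the two values are -1 and q - 1, and the coordinates
      where \<open>u\<close> is nonzero are counted by its level weight.\<close>
    by (intro prod.cong refl, subst sum_subsets_prod_two_valued)
      (use levels in \<open>auto simp: level_partition_def krawtchouk_def weight_spectrum_def level_weight_def\<close>)
  finally show ?thesis .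
qed

lemma sum_over_code:
  fixes C :: "('a ^ 'p::finite) set"
  assumes levels: "level_partition s n L" and code: "linear_code C"
  shows "(\<Sum>u\<in>C. \<psi> (level_inner s L u v)) = (if v \<in> dual_code s L C then of_nat (card C) else 0)"
proof (cases "v \<in> dual_code s L C")
  case True
  then show ?thesis by (simp add: dual_code_def)
next
  case False
  then obtain u where u: "u \<in> C" "level_inner s L u v \<noteq> 0"
    by (auto simp: dual_code_def)
  \<comment> \<open>\<psi> may be 1 at the nonzero inner product itself. Replacing \<open>u\<close>
    by its multiple by \<open>r\<close>, which remains in the submodule \<open>C\<close>, gives a
    codeword with character value different from 1.\<close>
  from generating[OF u(2)] obtain r where r: "\<psi> (level_inner s L u v * r) \<noteq> 1" by blast
  have "level_inner s L (r *s u) v = level_inner s L u v * r"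
    by (simp add: level_inner_def sum_distrib_right sum_distrib_left mult.commute mult.left_commute)
  then have "\<psi> (level_inner s L (r *s u) v) \<noteq> 1" using r by simp
  moreover have "r *s u \<in> C"
    using module.subspace_scale[OF module_vec] code u by (auto simp: linear_code_def)
  ultimately have "(\<Sum>u\<in>C. \<psi> (level_inner s L u v)) = 0"
  proof (intro character_sum_eq_0)
    show "x + y \<in> C" if "x \<in> C" "y \<in> C" for x y
      using module.subspace_add[OF module_vec] code that by (auto simp: linear_code_def)
    show "\<psi> (level_inner s L (x + y) v) = \<psi> (level_inner s L x v) * \<psi> (level_inner s L y v)" for x y
      by (simp add: level_inner_def distrib_right sum.distrib flip: add)
  qed auto
  then show ?thesis using False by simp
qed

text \<open>Both sides evaluate the double sum of \<psi> over the inner products of all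
  \<open>u\<close> in \<open>C\<close> with all \<open>v\<close> of spectrum \<open>m\<close>:
  summing over \<open>u\<close> first gives the left side, over \<open>v\<close> first the right
  side.\<close>

theorem spectrum_count_dual:
  fixes C :: "('a ^ 'p::finite) set"
  assumes levels: "level_partition s n L" and code: "linear_code C"
    and m: "m \<in> (\<Pi>\<^sub>E j\<in>{1..s}. {0..n j})"
  shows "rat_of_nat (card C) * of_nat (spectrum_count s L (dual_code s L C) m) =
    (\<Sum>l\<in>(\<Pi>\<^sub>E j\<in>{1..s}. {0..n j}). of_nat (spectrum_count s L C l) *
       (\<Prod>j\<in>{1..s}. krawtchouk CARD('a) (n j) (l j) (m j)))"
proof -
  let ?V = "{v :: 'a ^ 'p. weight_spectrum s L v = m}"
  have "complex_of_nat (card C) * of_nat (spectrum_count s L (dual_code s L C) m) =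
      (\<Sum>v\<in>?V. if v \<in> dual_code s L C then of_nat (card C) else 0)"
    by (simp add: sum.If_cases spectrum_count_def Int_def conj_commute)
  also have "\<dots> = (\<Sum>v\<in>?V. \<Sum>u\<in>C. \<psi> (level_inner s L u v))"
    by (simp add: sum_over_code[OF levels code])
  also have "\<dots> = (\<Sum>u\<in>C. \<Sum>v\<in>?V. \<psi> (level_inner s L u v))"
    by (rule sum.swap)
  also have "\<dots> = (\<Sum>u\<in>C. \<Prod>j\<in>{1..s}.
      krawtchouk CARD('a) (n j) (weight_spectrum s L u j) (m j))"
    by (simp add: sum_fixed_spectrum[OF levels m])
  also have "\<dots> = (\<Sum>l\<in>(\<Pi>\<^sub>E j\<in>{1..s}. {0..n j}). of_nat (spectrum_count s L C l) *
       (\<Prod>j\<in>{1..s}. krawtchouk CARD('a) (n j) (l j) (m j)))"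
    by (rule sum_by_spectrum[OF levels])
  \<comment> \<open>The complex identity is the image of a rational one under the injective map
    \<open>of_rat\<close>.\<close>
  finally have "(of_rat (rat_of_nat (card C) * of_nat (spectrum_count s L (dual_code s L C) m)) :: complex) =
    of_rat (\<Sum>l\<in>(\<Pi>\<^sub>E j\<in>{1..s}. {0..n j}). of_nat (spectrum_count s L C l) *
       (\<Prod>j\<in>{1..s}. krawtchouk CARD('a) (n j) (l j) (m j)))"
    by (simp add: of_rat_mult of_rat_sum of_rat_prod of_rat_krawtchouk)
  then show ?thesis by (simp only: of_rat_eq_iff)
qed

end

section \<open>From coefficients to polynomials\<close>

lemma const_poly_mult: "const_poly (a * b) = const_poly a * const_poly b"
  by (simp add: const_poly_def mult_single)

lemma const_poly_add: "const_poly (a + b) = const_poly a + const_poly b"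
  by (simp add: const_poly_def single_add)

lemma const_poly_0 [simp]: "const_poly 0 = 0"
  by (simp add: const_poly_def)

lemma const_poly_1 [simp]: "const_poly 1 = 1"
  by (simp add: const_poly_def)

lemma const_poly_of_nat: "const_poly (of_nat k) = of_nat k"
  by (induction k) (auto simp: const_poly_add)

lemma const_poly_sum: "const_poly (\<Sum>i\<in>A. f i) = (\<Sum>i\<in>A. const_poly (f i))"
  by (induction A rule: infinite_finite_induct) (auto simp: const_poly_add)

lemma const_poly_prod: "const_poly (\<Prod>i\<in>A. f i) = (\<Prod>i\<in>A. const_poly (f i))"
  by (induction A rule: infinite_finite_induct) (auto simp: const_poly_mult)

theorem theorem4p1:
  fixes C :: "('a::{comm_ring_1, finite} ^ 'p::{finite, order}) set"
    and L :: "nat \<Rightarrow> 'p set" and n :: "nat \<Rightarrow> nat" and s q :: nat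
  assumes frobenius: "frobenius_ring TYPE('a)"
    and q: "q = CARD('a)"
    and levels: "level_partition s n L"
    and code: "linear_code C"
  shows "level_weight_enumerator s L (dual_code s L C) =
    const_poly (1 / of_nat (card C)) *
    (\<Sum>l \<in> (\<Pi>\<^sub>E j\<in>{1..s}. {0..n j}).
       of_nat (spectrum_count s L C l) *
       (\<Prod>j\<in>{1..s}. \<Sum>p=0..n j.
          const_poly (\<Sum>a=0..p. (-1) ^ a * (of_nat q - 1) ^ (p - a) *
            of_nat (l j choose a) * of_nat ((n j - l j) choose (p - a))) *
          indet j p))"
proof -
  obtain \<psi> :: "'a \<Rightarrow> complex" where "generating_character \<psi>"
    using frobenius by (rule frobenius_ring_generating_character)
  then interpret generating_character \<psi> .
  let ?M = "\<Pi>\<^sub>E j\<in>{1..s}. {0..n j}"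
  let ?K = "\<lambda>l m. \<Prod>j\<in>{1..s}. krawtchouk CARD('a) (n j) (l j) (m j) :: rat"
  let ?z = "\<lambda>m. \<Prod>j\<in>{1..s}. indet j (m j)"
  \<comment> \<open>This makes \<open>card C\<close> nonzero, so that the factor 1 / |C| really
    cancels.\<close>
  have "0 \<in> C"
    using module.subspace_0[OF module_vec] code by (auto simp: linear_code_def)
  then have C: "card C \<noteq> 0" by auto
  \<comment> \<open>Multiplying out the product over levels picks one index \<open>p\<close> per
    level; the picks form a spectrum \<open>m\<close>, with monomial \<open>?z m\<close>.\<close>
  have expand: "(\<Sum>l\<in>?M. of_nat (spectrum_count s L C l) *
       (\<Prod>j\<in>{1..s}. \<Sum>p=0..n j.
          const_poly (\<Sum>a=0..p. (-1) ^ a * (of_nat q - 1) ^ (p - a) *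
            of_nat (l j choose a) * of_nat ((n j - l j) choose (p - a))) * indet j p)) =
      (\<Sum>l\<in>?M. of_nat (spectrum_count s L C l) * (\<Sum>m\<in>?M. const_poly (?K l m) * ?z m))"
    by (simp add: prod_sum_PiE const_poly_prod prod.distrib q flip: krawtchouk_def)
  \<comment> \<open>Exchanging the sums collects the coefficient of each monomial
    \<open>?z m\<close>, to which the identity for a single spectrum applies.\<close>
  have "(\<Sum>l\<in>?M. of_nat (spectrum_count s L C l) * (\<Sum>m\<in>?M. const_poly (?K l m) * ?z m)) =
      (\<Sum>m\<in>?M. const_poly (\<Sum>l\<in>?M. of_nat (spectrum_count s L C l) * ?K l m) * ?z m)"
    unfolding sum_distrib_left
    by (subst sum.swap)
      (simp add: const_poly_sum const_poly_mult const_poly_of_nat sum_distrib_right mult.assoc)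
  also have "\<dots> = (\<Sum>m\<in>?M. const_poly (of_nat (card C) *
      of_nat (spectrum_count s L (dual_code s L C) m)) * ?z m)"
    by (intro sum.cong refl) (simp add: spectrum_count_dual[OF levels code])
  finally have "const_poly (1 / of_nat (card C)) *
      (\<Sum>l\<in>?M. of_nat (spectrum_count s L C l) * (\<Sum>m\<in>?M. const_poly (?K l m) * ?z m)) =
      const_poly (1 / of_nat (card C)) * (\<Sum>m\<in>?M. const_poly (of_nat (card C) *
        of_nat (spectrum_count s L (dual_code s L C) m)) * ?z m)"
    by (rule arg_cong)
  also have "\<dots> = (\<Sum>m\<in>?M. of_nat (spectrum_count s L (dual_code s L C) m) * ?z m)"
    unfolding sum_distrib_left
    by (intro sum.cong refl)
      (use C in \<open>simp add: const_poly_of_nat flip: mult.assoc const_poly_mult\<close>)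
  \<comment> \<open>The grouping by spectra is undone for the dual code, returning to one monomial
    per dual codeword.\<close>
  also have "\<dots> = (\<Sum>u\<in>dual_code s L C. ?z (weight_spectrum s L u))"
    by (rule sum_by_spectrum[OF levels, symmetric])
  also have "\<dots> = level_weight_enumerator s L (dual_code s L C)"
    by (simp add: level_weight_enumerator_def weight_spectrum_def)
  finally show ?thesis
    unfolding expand by (rule sym)
qed

end
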